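(* Let $(\alpha,\beta)$ be a random vector in $\mathbb{R}^2$ such that (i) $\mathbb{P}(\alpha\neq 0)=1$; (ii) $\mathbb{P}(|\alpha|\neq 1)>0$; (iii) for every $c\in\mathbb{R}$, $\mathbb{P}(\alpha(c-\beta)=c)<1$. Assume that $$-\infty<\mathbb{E}\{\ln|\alpha|\}<0,\qquad \mathbb{E}\{\ln\max(|\beta|,1)\}<\infty .$$ Then every bounded continuous function $y:\mathbb{R}\to\mathbb{R}$ satisfying $$y(x)=\mathbb{E}\{y(\alpha(x-\beta))\},\qquad x\in\mathbb{R},$$ is constant.
   Context: Expectations $\mathbb{E}$ are taken with respect to the joint distribution of $(\alpha,\beta)$; $\alpha$ and $\beta$ need not be independent of each other. *)

theory Defs
  imports "HOL-Probability.Probability"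
begin

end

(* Unfolding the functional equation along an i.i.d. sequence of maps f_i(x) = a_i (x - b_i) gives
   y(x) = E y(f_1 o ... o f_n (x)).  Composed in this order, the iterates converge almost surely to
   a limit that does not depend on x, because |a_1 ... a_k b_k| decays geometrically; by bounded
   convergence y is constant.  The decay comes from the fact that partial sums of i.i.d. variables
   with negative mean are almost surely bounded above. *)

theory Submission
  imports Defs
begin

section \<open>The i.i.d. sequence space: splitting off the first letter, shift invariance\<close>

context prob_space
begin

text \<open>The recursive formula \<open>emeasure_stream_space\<close> and the section formula for
  product measures give the same integral over the first letter. Shift invariance and Fubini below
  are read off from this identity.\<close>

lemma distr_Stream:
  "distr (M \<Otimes>\<^sub>M stream_space M) (stream_space M) (\<lambda>(x, \<omega>). x ## \<omega>) = stream_space M"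
proof (rule measure_eqI)
  interpret S: prob_space "stream_space M" by (rule prob_space_stream_space)
  fix A assume "A \<in> sets (distr (M \<Otimes>\<^sub>M stream_space M) (stream_space M) (\<lambda>(x, \<omega>). x ## \<omega>))"
  then have A [measurable]: "A \<in> sets (stream_space M)" by simp
  show "emeasure (distr (M \<Otimes>\<^sub>M stream_space M) (stream_space M) (\<lambda>(x, \<omega>). x ## \<omega>)) A
    = emeasure (stream_space M) A"
    by (subst emeasure_stream_space[OF A])
      (auto simp: emeasure_distr S.emeasure_pair_measure_alt space_pair_measure
        intro!: nn_integral_cong arg_cong2[where f = emeasure])
qed simp

lemma distr_shd: "distr (stream_space M) M shd = M"
proof -
  interpret S: prob_space "stream_space M" by (rule prob_space_stream_space)
  have "distr (stream_space M) M shd = distr (M \<Otimes>\<^sub>M stream_space M) M fst"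
    by (subst distr_Stream[symmetric], subst distr_distr)
      (auto intro!: distr_cong simp: comp_def)
  then show ?thesis
    by (simp add: S.distr_pair_fst)
qed

lemma distr_stl: "distr (stream_space M) (stream_space M) stl = stream_space M"
proof -
  interpret S: prob_space "stream_space M" by (rule prob_space_stream_space)
  interpret P: pair_sigma_finite M "stream_space M" ..
  have "distr (stream_space M) (stream_space M) stl = distr (M \<Otimes>\<^sub>M stream_space M) (stream_space M) snd"
    by (subst (1) distr_Stream[symmetric], subst distr_distr)
      (auto intro!: distr_cong simp: comp_def)
  also have "\<dots> = distr (stream_space M \<Otimes>\<^sub>M M) (stream_space M) fst"
    by (subst P.distr_pair_swap, subst distr_distr)
      (auto intro!: distr_cong simp: comp_def)
  finally show ?thesis
    by (simp add: distr_pair_fst)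
qed

lemma integrable_shd:
  fixes f :: "'a \<Rightarrow> real"
  assumes "integrable M f"
  shows "integrable (stream_space M) (\<lambda>\<omega>. f (shd \<omega>))"
  using assms by (subst (asm) distr_shd[symmetric]) (erule integrable_distr[rotated], simp)

lemma integrable_stl:
  fixes f :: "'a stream \<Rightarrow> real"
  assumes "integrable (stream_space M) f"
  shows "integrable (stream_space M) (\<lambda>\<omega>. f (stl \<omega>))"
  using assms by (subst (asm) distr_stl[symmetric]) (erule integrable_distr[rotated], simp)

lemma integral_stl:
  fixes f :: "'a stream \<Rightarrow> real"
  assumes "f \<in> borel_measurable (stream_space M)"
  shows "(\<integral>\<omega>. f (stl \<omega>) \<partial>stream_space M) = (\<integral>\<omega>. f \<omega> \<partial>stream_space M)"
  using assms by (subst (2) distr_stl[symmetric], subst integral_distr) auto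

text \<open>Fubini with the first letter integrated innermost, the tail being fixed. This order
  serves integrands whose dependence on the first letter is explicit.\<close>

lemma integral_stream_space_snd:
  fixes f :: "'a stream \<Rightarrow> real"
  assumes f: "integrable (stream_space M) f"
  shows "(\<integral>\<omega>. \<integral>x. f (x ## \<omega>) \<partial>M \<partial>stream_space M) = (\<integral>\<omega>. f \<omega> \<partial>stream_space M)"
proof -
  interpret S: prob_space "stream_space M" by (rule prob_space_stream_space)
  interpret P: pair_sigma_finite M "stream_space M" ..
  have "integrable (M \<Otimes>\<^sub>M stream_space M) (\<lambda>p. f (case p of (x, \<omega>) \<Rightarrow> x ## \<omega>))"
    using f by (subst (asm) distr_Stream[symmetric]) (erule integrable_distr[rotated], simp)
  then have int: "integrable (M \<Otimes>\<^sub>M stream_space M) (\<lambda>(x, \<omega>). f (x ## \<omega>))"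
    by (simp add: case_prod_beta')
  have "(\<integral>\<omega>. f \<omega> \<partial>stream_space M) = (\<integral>p. f (case p of (x, \<omega>) \<Rightarrow> x ## \<omega>) \<partial>(M \<Otimes>\<^sub>M stream_space M))"
    using f by (subst (1) distr_Stream[symmetric], subst integral_distr) auto
  also have "\<dots> = (\<integral>(x, \<omega>). f (x ## \<omega>) \<partial>(M \<Otimes>\<^sub>M stream_space M))"
    by (simp add: case_prod_beta')
  finally show ?thesis
    using P.integral_snd[OF int] by simp
qed

end

section \<open>Running maxima of partial sums and the maximal ergodic inequality\<close>

text \<open>This is the maximum over 0 \<le> k \<le> n of the k-th partial sum of \<open>f\<close>
  along the stream. The Lindley-type recursion on the tail ties it directly to the shift.\<close>

primrec max_excess :: "('a \<Rightarrow> real) \<Rightarrow> nat \<Rightarrow> 'a stream \<Rightarrow> real" where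
  "max_excess f 0 \<omega> = 0"
| "max_excess f (Suc n) \<omega> = max 0 (f (shd \<omega>) + max_excess f n (stl \<omega>))"

lemma max_excess_nonneg: "0 \<le> max_excess f n \<omega>"
  by (cases n) auto

lemma max_excess_le_Suc: "max_excess f n \<omega> \<le> max_excess f (Suc n) \<omega>"
proof (induction n arbitrary: \<omega>)
  case (Suc n)
  have "f (shd \<omega>) + max_excess f n (stl \<omega>) \<le> f (shd \<omega>) + max_excess f (Suc n) (stl \<omega>)"
    using Suc by (intro add_left_mono)
  then show ?case
    unfolding max_excess.simps(2)[of f n \<omega>] max_excess.simps(2)[of f "Suc n" \<omega>]
    by (rule max.mono[OF order_refl])
qed simp

lemma mono_max_excess: "m \<le> n \<Longrightarrow> max_excess f m \<omega> \<le> max_excess f n \<omega>"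
  using max_excess_le_Suc by (rule lift_Suc_mono_le)

lemma sum_le_max_excess: "(\<Sum>i<n. f (\<omega> !! i)) \<le> max_excess f n \<omega>"
proof (induction n arbitrary: \<omega>)
  case (Suc n)
  have "(\<Sum>i<Suc n. f (\<omega> !! i)) = f (shd \<omega>) + (\<Sum>i<n. f (stl \<omega> !! i))"
    by (simp only: sum.lessThan_Suc_shift snth.simps)
  also have "\<dots> \<le> f (shd \<omega>) + max_excess f n (stl \<omega>)"
    by (intro add_left_mono Suc)
  also have "\<dots> \<le> max_excess f (Suc n) \<omega>"
    by simp
  finally show ?case .
qed simp

lemma measurable_max_excess [measurable]:
  assumes [measurable]: "f \<in> borel_measurable M"
  shows "max_excess f n \<in> borel_measurable (stream_space M)"
  by (induction n) (auto simp: measurable_compose[OF measurable_stl])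

context prob_space
begin

lemma integrable_max_excess:
  assumes "integrable M f"
  shows "integrable (stream_space M) (max_excess f n)"
proof -
  interpret S: prob_space "stream_space M" by (rule prob_space_stream_space)
  show ?thesis
  proof (induction n)
    case 0
    have "max_excess f 0 = (\<lambda>_. 0)" by (rule ext) simp
    then show ?case by simp
  next
    case (Suc n)
    have "max_excess f (Suc n) = (\<lambda>\<omega>. max 0 (f (shd \<omega>) + max_excess f n (stl \<omega>)))"
      by (rule ext) simp
    then show ?case
      using integrable_shd[OF assms] integrable_stl[OF Suc] by simp
  qed
qed

text \<open>Garsia's argument for the maximal ergodic inequality, restricted to the shift-invariant event
  on which the running maximum is unbounded.  By invariance this event does not depend on the first
  coordinate, so the inequality reads \<open>0 \<le> \<integral>f \<cdot> \<P>(A)\<close>.\<close>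
lemma AE_max_excess_bounded:
  assumes f: "integrable M f" and neg: "(\<integral>x. f x \<partial>M) < 0"
  shows "AE \<omega> in stream_space M. \<exists>C. \<forall>n. max_excess f n \<omega> \<le> C"
proof -
  let ?S = "stream_space M" and ?m = "max_excess f"
  interpret S: prob_space ?S by (rule prob_space_stream_space)
  have [measurable]: "f \<in> borel_measurable M" using f by auto
  \<comment> \<open>Thresholds in the naturals keep the event a countable combination of measurable
    sets.\<close>
  define P where "P \<omega> \<longleftrightarrow> (\<forall>k::nat. \<exists>n. real k < ?m n \<omega>)" for \<omega>
  define A where "A = {\<omega> \<in> space ?S. P \<omega>}"
  have A [measurable]: "A \<in> sets ?S" unfolding A_def P_def by measurable
  \<comment> \<open>Up to an index shift, the maxima of \<open>\<omega>\<close> and of its tail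
    differ by at most \<open>\<bar>f (shd \<omega>)\<bar>\<close>; raising the threshold by this
    amount carries unboundedness over in both directions.\<close>
  have inv: "P (stl \<omega>) \<longleftrightarrow> P \<omega>" for \<omega>
  proof
    assume *: "P (stl \<omega>)"
    show "P \<omega>" unfolding P_def
    proof
      fix k
      obtain n where "real (k + nat \<lceil>\<bar>f (shd \<omega>)\<bar>\<rceil>) < ?m n (stl \<omega>)"
        using * unfolding P_def by blast
      then have "real k < ?m (Suc n) \<omega>" by simp linarith
      then show "\<exists>n. real k < ?m n \<omega>" ..
    qed
  next
    assume *: "P \<omega>"
    show "P (stl \<omega>)" unfolding P_def
    proof
      fix k
      obtain n where "real (k + nat \<lceil>\<bar>f (shd \<omega>)\<bar>\<rceil>) < ?m n \<omega>"
        using * unfolding P_def by blast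
      then have "real (k + nat \<lceil>\<bar>f (shd \<omega>)\<bar>\<rceil>) < ?m (Suc n) \<omega>"
        using max_excess_le_Suc[of f n \<omega>] by linarith
      then have "real k < ?m n (stl \<omega>)"
        unfolding max_excess.simps by linarith
      then show "\<exists>n. real k < ?m n (stl \<omega>)" ..
    qed
  qed
  define I :: "'a stream \<Rightarrow> real" where "I = indicator A"
  have [measurable]: "I \<in> borel_measurable ?S" unfolding I_def by simp
  have I_bd: "0 \<le> I \<omega>" "I \<omega> \<le> 1" for \<omega> by (auto simp: I_def)
  have I_stl: "I (stl \<omega>) = I \<omega>" if "\<omega> \<in> space ?S" for \<omega>
    using that measurable_space[OF measurable_stl that] by (auto simp: I_def A_def inv indicator_def)
  have I_Stream: "I (x ## \<omega>) = I \<omega>" if "x \<in> space M" "\<omega> \<in> space ?S" for x \<omega>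
    using that I_stl[of "x ## \<omega>"] by (simp add: stream_space_Stream)
  have int: "integrable ?S (\<lambda>\<omega>. g \<omega> * I \<omega>)" if "integrable ?S g" for g
    unfolding I_def using integrable_real_mult_indicator[OF A that] by (simp add: mult.commute)
  \<comment> \<open>Equivalently, \<open>D n \<omega>\<close> is the maximum of
    \<open>f (shd \<omega>)\<close> and \<open>- ?m n (stl \<omega>)\<close>. The second entry is
    never positive, hence the bound by \<open>\<bar>f (shd \<omega>)\<bar>\<close>.\<close>
  define D where "D n \<omega> = ?m (Suc n) \<omega> - ?m n (stl \<omega>)" for n \<omega>
  have D_bd: "\<bar>D n \<omega>\<bar> \<le> \<bar>f (shd \<omega>)\<bar>" for n \<omega>
    using max_excess_nonneg[of f n "stl \<omega>"] by (auto simp: D_def)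
  have [measurable]: "D n \<in> borel_measurable ?S" for n
    unfolding D_def by (intro borel_measurable_diff measurable_max_excess
      measurable_compose[OF measurable_stl]) auto
  \<comment> \<open>Since \<open>I\<close> is invariant, the shift can be removed under the
    integral; what remains is monotonicity of the maxima in \<open>n\<close>.\<close>
  have nonneg: "0 \<le> (\<integral>\<omega>. D n \<omega> * I \<omega> \<partial>?S)" for n
  proof -
    note m = integrable_max_excess[OF f]
    have "(\<integral>\<omega>. ?m n (stl \<omega>) * I \<omega> \<partial>?S) = (\<integral>\<omega>. ?m n (stl \<omega>) * I (stl \<omega>) \<partial>?S)"
      by (intro Bochner_Integration.integral_cong) (auto simp: I_stl)
    also have "\<dots> = (\<integral>\<omega>. ?m n \<omega> * I \<omega> \<partial>?S)"
      by (rule integral_stl[of "\<lambda>\<omega>. ?m n \<omega> * I \<omega>"]) measurable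
    also have "\<dots> \<le> (\<integral>\<omega>. ?m (Suc n) \<omega> * I \<omega> \<partial>?S)"
      by (intro integral_mono int m mult_right_mono max_excess_le_Suc I_bd)
    finally show ?thesis
      using int[OF m[of "Suc n"]] int[OF integrable_stl[OF m[of n]]]
      by (simp add: D_def left_diff_distrib del: max_excess.simps)
  qed
  \<comment> \<open>On \<open>A\<close> the maxima of the tail eventually exceed
    \<open>\<bar>f (shd \<omega>)\<bar>\<close>, so the cut-off at 0 becomes inactive and
    \<open>D\<close> equals \<open>f (shd \<omega>)\<close>. Off \<open>A\<close> both sides
    vanish.\<close>
  have lim: "(\<lambda>n. D n \<omega> * I \<omega>) \<longlonglongrightarrow> f (shd \<omega>) * I \<omega>" for \<omega>
  proof (cases "\<omega> \<in> A")
    case True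
    then have "P (stl \<omega>)" by (auto simp: A_def inv)
    then obtain N where N: "real (nat \<lceil>\<bar>f (shd \<omega>)\<bar>\<rceil>) < ?m N (stl \<omega>)"
      unfolding P_def by blast
    have "D n \<omega> = f (shd \<omega>)" if "n \<ge> N" for n
      using N mono_max_excess[OF that, of f "stl \<omega>"] unfolding D_def max_excess.simps by linarith
    then have "\<forall>\<^sub>F n in sequentially. D n \<omega> * I \<omega> = f (shd \<omega>) * I \<omega>"
      by (intro eventually_sequentiallyI[of N]) auto
    then show ?thesis by (rule tendsto_eventually)
  qed (simp add: I_def)
  have "(\<lambda>n. \<integral>\<omega>. D n \<omega> * I \<omega> \<partial>?S) \<longlonglongrightarrow> (\<integral>\<omega>. f (shd \<omega>) * I \<omega> \<partial>?S)"
  proof (rule integral_dominated_convergence[where w = "\<lambda>\<omega>. \<bar>f (shd \<omega>)\<bar>"])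
    show "integrable ?S (\<lambda>\<omega>. \<bar>f (shd \<omega>)\<bar>)" using integrable_shd[OF f] by simp
    show "AE \<omega> in ?S. norm (D n \<omega> * I \<omega>) \<le> \<bar>f (shd \<omega>)\<bar>" for n
      using mult_mono[OF D_bd I_bd(2)] I_bd(1) by (auto simp: abs_mult)
  qed (auto simp: lim)
  then have "0 \<le> (\<integral>\<omega>. f (shd \<omega>) * I \<omega> \<partial>?S)"
    using nonneg by (intro LIMSEQ_le_const) auto
  \<comment> \<open>With the tail fixed, \<open>I\<close> is constant in the first letter, so the
    integral factors into the mean of \<open>f\<close> and the measure of \<open>A\<close>.\<close>
  also have "\<dots> = (\<integral>\<omega>. \<integral>x. f (shd (x ## \<omega>)) * I (x ## \<omega>) \<partial>M \<partial>?S)"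
    by (rule integral_stream_space_snd[symmetric]) (intro int integrable_shd f)
  also have "\<dots> = (\<integral>\<omega>. \<integral>x. f x * I \<omega> \<partial>M \<partial>?S)"
    by (intro Bochner_Integration.integral_cong) (auto simp: I_Stream)
  also have "\<dots> = (\<integral>x. f x \<partial>M) * measure ?S A"
    using f S.emeasure_finite by (simp add: I_def)
  finally have "measure ?S A = 0"
    using neg measure_nonneg[of ?S A] by (simp add: zero_le_mult_iff)
  then have "AE \<omega> in ?S. \<omega> \<notin> A"
    using A by (simp add: S.prob_eq_0 AE_iff_null_sets null_sets_def S.emeasure_eq_measure)
  with AE_space show ?thesis
    by eventually_elim (auto simp: A_def P_def not_less)
qed

end

section \<open>Backward iterates of random maps\<close>

text \<open>The first letter drives the outermost map, so raising \<open>n\<close> inserts the new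
  map innermost, next to \<open>x\<close>. For contracting maps this order allows pathwise
  convergence.\<close>

primrec backward_iterate :: "('a \<Rightarrow> 'b \<Rightarrow> 'b) \<Rightarrow> nat \<Rightarrow> 'a stream \<Rightarrow> 'b \<Rightarrow> 'b" where
  "backward_iterate F 0 \<omega> x = x"
| "backward_iterate F (Suc n) \<omega> x = F (shd \<omega>) (backward_iterate F n (stl \<omega>) x)"

text \<open>The starting point enters only through the product, and the subtracted sum merely gains
  a term as \<open>n\<close> grows. Convergence thus reduces to a vanishing product and a convergent
  series.\<close>

lemma backward_iterate_affine:
  fixes a b :: "'a \<Rightarrow> real"
  shows "backward_iterate (\<lambda>s x. a s * (x - b s)) n \<omega> x =
    (\<Prod>i<n. a (\<omega> !! i)) * x - (\<Sum>k<n. (\<Prod>i<Suc k. a (\<omega> !! i)) * b (\<omega> !! k))"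
proof (induction n arbitrary: \<omega>)
  case (Suc n)
  show ?case
    unfolding sum.lessThan_Suc_shift[of _ n] prod.lessThan_Suc_shift backward_iterate.simps Suc
    by (simp add: sum_distrib_left algebra_simps)
qed simp

lemma measurable_backward_iterate:
  assumes F: "case_prod F \<in> borel_measurable (M \<Otimes>\<^sub>M borel)"
  shows "(\<lambda>\<omega>. backward_iterate F n \<omega> x) \<in> borel_measurable (stream_space M)"
proof (induction n)
  case (Suc n)
  have "(\<lambda>\<omega>. (shd \<omega>, backward_iterate F n (stl \<omega>) x)) \<in> stream_space M \<rightarrow>\<^sub>M M \<Otimes>\<^sub>M borel"
    by (intro measurable_Pair measurable_shd measurable_compose[OF measurable_stl Suc])
  from measurable_compose[OF this F] show ?case by simp
qed simp

text \<open>Equality holds for nonzero \<open>x\<close>; at 0 the convention \<open>ln 0 = 0\<close>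
  makes the right side 1. Upper bounds on products ask for no more.\<close>

lemma abs_le_exp_ln: "\<bar>x\<bar> \<le> exp (ln \<bar>x\<bar>)" for x :: real
  by (cases "x = 0") auto

context prob_space
begin

text \<open>Integrating out the first letter averages over the outermost map, which harmonicity
  removes; the tail is then an iterate of length one less.\<close>

lemma integral_backward_iterate:
  fixes y :: "real \<Rightarrow> real"
  assumes F: "case_prod F \<in> borel_measurable (M \<Otimes>\<^sub>M borel)"
    and y [measurable]: "y \<in> borel_measurable borel" and bd: "\<And>x. \<bar>y x\<bar> \<le> B"
    and harmonic: "\<And>x. y x = (\<integral>s. y (F s x) \<partial>M)"
  shows "(\<integral>\<omega>. y (backward_iterate F n \<omega> x) \<partial>stream_space M) = y x"
proof (induction n)
  interpret S: prob_space "stream_space M" by (rule prob_space_stream_space)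
  case 0
  show ?case by (simp add: S.prob_space)
next
  interpret S: prob_space "stream_space M" by (rule prob_space_stream_space)
  case (Suc n)
  have "integrable (stream_space M) (\<lambda>\<omega>. y (backward_iterate F (Suc n) \<omega> x))"
    using bd by (intro S.integrable_const_bound[where B = B]
      measurable_compose[OF measurable_backward_iterate[OF F] y]) auto
  from integral_stream_space_snd[OF this]
  have "(\<integral>\<omega>. y (backward_iterate F (Suc n) \<omega> x) \<partial>stream_space M) =
      (\<integral>\<omega>. \<integral>s. y (F s (backward_iterate F n \<omega> x)) \<partial>M \<partial>stream_space M)"
    by simp
  also have "\<dots> = (\<integral>\<omega>. y (backward_iterate F n \<omega> x) \<partial>stream_space M)"
    by (simp add: harmonic[symmetric])
  finally show ?case using Suc by simp
qed

section \<open>Almost sure convergence of the affine iterates\<close>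

lemma integral_excess_tendsto_0:
  fixes f :: "'a \<Rightarrow> real"
  assumes f: "integrable M f"
  shows "(\<lambda>n. \<integral>x. max 0 (f x - real n) \<partial>M) \<longlonglongrightarrow> 0"
proof -
  have "(\<lambda>n. \<integral>x. max 0 (f x - real n) \<partial>M) \<longlonglongrightarrow> (\<integral>x. 0 \<partial>M)"
  proof (rule integral_dominated_convergence[where w = "\<lambda>x. \<bar>f x\<bar>"])
    have "\<forall>\<^sub>F n in sequentially. max 0 (f x - real n) = 0" for x
      by (rule eventually_sequentiallyI[of "nat \<lceil>f x\<rceil>"]) linarith
    then show "AE x in M. (\<lambda>n. max 0 (f x - real n)) \<longlonglongrightarrow> 0"
      by (intro AE_I2 tendsto_eventually)
  qed (use f in auto)
  then show ?thesis by simp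
qed

text \<open>The truncation level \<open>L\<close> makes the excess of \<open>ln\<^sup>+ \<bar>b\<bar>\<close> over \<open>L\<close> so small in mean that it can be
  added to \<open>ln \<bar>a\<bar>\<close> without destroying the negative drift.  A single use of the maximal inequality
  then controls the factors \<open>b\<close> together with the products of the \<open>a\<close>.\<close>
lemma AE_backward_iterate_affine_tendsto:
  fixes a b :: "'a \<Rightarrow> real"
  assumes a: "integrable M (\<lambda>s. ln \<bar>a s\<bar>)" and neg: "(\<integral>s. ln \<bar>a s\<bar> \<partial>M) < 0"
    and b: "integrable M (\<lambda>s. ln (max \<bar>b s\<bar> 1))"
  shows "AE \<omega> in stream_space M. \<exists>z. \<forall>x.
    (\<lambda>n. backward_iterate (\<lambda>s x. a s * (x - b s)) n \<omega> x) \<longlonglongrightarrow> z"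
proof -
  define m where "m = (\<integral>s. ln \<bar>a s\<bar> \<partial>M)"
  \<comment> \<open>The budget: the excess will cost less than -m/2 and \<open>d\<close> costs -m/4,
    so the mean of \<open>f\<close> below stays under m/4, which is negative. The summand
    \<open>d\<close> turns bounded sums into decay at rate \<open>d\<close>.\<close>
  define d where "d = - m / 4"
  have d: "d > 0" using neg by (simp add: d_def m_def)
  have "\<forall>\<^sub>F n in sequentially. (\<integral>s. max 0 (ln (max \<bar>b s\<bar> 1) - real n) \<partial>M) < - m / 2"
    using integral_excess_tendsto_0[OF b] neg by (intro order_tendstoD) (auto simp: m_def)
  then obtain N where N: "(\<integral>s. max 0 (ln (max \<bar>b s\<bar> 1) - real N) \<partial>M) < - m / 2"
    by (auto simp: eventually_sequentially)
  define L where "L = real N"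
  define e where "e s = max 0 (ln (max \<bar>b s\<bar> 1) - L)" for s
  define f where "f s = ln \<bar>a s\<bar> + e s + d" for s
  have e: "integrable M e"
    unfolding e_def using b by (intro integrable_max) auto
  have "integrable M f"
    unfolding f_def using a e by auto
  moreover have "(\<integral>s. f s \<partial>M) = m + (\<integral>s. e s \<partial>M) + d"
    unfolding f_def using a e by (simp add: prob_space m_def)
  then have "(\<integral>s. f s \<partial>M) < 0"
    using N d by (simp add: d_def e_def L_def)
  ultimately have "AE \<omega> in stream_space M. \<exists>C. \<forall>n. max_excess f n \<omega> \<le> C"
    by (rule AE_max_excess_bounded)
  then show ?thesis
  proof eventually_elim
    case (elim \<omega>)
    then obtain C where "\<And>n. max_excess f n \<omega> \<le> C" by blast
    then have "(\<Sum>i<n. f (\<omega> !! i)) \<le> C" for n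
      using sum_le_max_excess by (rule order_trans[rotated])
    then have C: "(\<Sum>i<n. ln \<bar>a (\<omega> !! i)\<bar>) + (\<Sum>i<n. e (\<omega> !! i)) \<le> C - real n * d" for n
      by (simp add: f_def sum.distrib algebra_simps)
    define p where "p n = (\<Prod>i<n. a (\<omega> !! i))" for n
    have p: "\<bar>p n\<bar> \<le> exp (\<Sum>i<n. ln \<bar>a (\<omega> !! i)\<bar>)" for n
      unfolding p_def abs_prod exp_sum[OF finite_lessThan] by (intro prod_mono conjI abs_ge_zero abs_le_exp_ln)
    have geom: "exp (c - real n * d) = exp c * exp (- d) ^ n" for c n
      by (simp add: exp_of_nat_mult[symmetric] exp_add[symmetric])
    have e_nonneg: "0 \<le> e s" for s by (simp add: e_def)
    have "\<bar>p n\<bar> \<le> exp C * exp (- d) ^ n" for n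
    proof -
      have "(\<Sum>i<n. ln \<bar>a (\<omega> !! i)\<bar>) \<le> C - real n * d"
        using C[of n] sum_nonneg[of "{..<n}" "\<lambda>i. e (\<omega> !! i)"] e_nonneg by fastforce
      then show ?thesis
        using p[of n] unfolding geom[symmetric] by (meson exp_le_cancel_iff order_trans)
    qed
    moreover have "(\<lambda>n. exp C * exp (- d) ^ n) \<longlonglongrightarrow> exp C * 0"
      using d by (intro tendsto_mult_left LIMSEQ_realpow_zero) auto
    ultimately have p_lim: "p \<longlonglongrightarrow> 0"
      by (intro Lim_null_comparison[of p "\<lambda>n. exp C * exp (- d) ^ n"]) auto
    \<comment> \<open>The factor \<open>b (\<omega> !! k)\<close> comes with \<open>Suc k\<close>
      factors \<open>a\<close>. Its logarithm is at most \<open>L\<close> plus one excess, and that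
      excess is already among the nonnegative summands bounded by \<open>C\<close>; only the
      constant \<open>exp L\<close> is lost.\<close>
    have "\<bar>p (Suc k) * b (\<omega> !! k)\<bar> \<le> exp (C + L) * exp (- d) ^ Suc k" for k
    proof -
      have "e (\<omega> !! k) \<le> (\<Sum>i<Suc k. e (\<omega> !! i))"
        using e_nonneg by (intro member_le_sum) auto
      then have *: "(\<Sum>i<Suc k. ln \<bar>a (\<omega> !! i)\<bar>) + ln (max \<bar>b (\<omega> !! k)\<bar> 1) \<le> C + L - real (Suc k) * d"
        using C[of "Suc k"] by (simp add: e_def)
      have "\<bar>b (\<omega> !! k)\<bar> \<le> exp (ln (max \<bar>b (\<omega> !! k)\<bar> 1))" by simp
      then have "\<bar>p (Suc k) * b (\<omega> !! k)\<bar>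
          \<le> exp (\<Sum>i<Suc k. ln \<bar>a (\<omega> !! i)\<bar>) * exp (ln (max \<bar>b (\<omega> !! k)\<bar> 1))"
        unfolding abs_mult by (intro mult_mono p) auto
      then show ?thesis
        unfolding exp_add[symmetric] geom[symmetric] using * by (meson exp_le_cancel_iff order_trans)
    qed
    moreover have "summable (\<lambda>k. exp (C + L) * exp (- d) ^ Suc k)"
      using d unfolding power_Suc by (intro summable_mult summable_geometric) simp
    ultimately have "summable (\<lambda>k. p (Suc k) * b (\<omega> !! k))"
      unfolding real_norm_def[symmetric] by (rule summable_comparison_test'[rotated])
    then have "(\<lambda>n. \<Sum>k<n. p (Suc k) * b (\<omega> !! k)) \<longlonglongrightarrow> (\<Sum>k. p (Suc k) * b (\<omega> !! k))"
      by (rule summable_LIMSEQ)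
    then have "(\<lambda>n. p n * x - (\<Sum>k<n. p (Suc k) * b (\<omega> !! k)))
        \<longlonglongrightarrow> 0 * x - (\<Sum>k. p (Suc k) * b (\<omega> !! k))" for x
      by (intro tendsto_intros p_lim)
    then show ?case
      unfolding backward_iterate_affine p_def mult_zero_left by blast
  qed
qed

end

section \<open>Constancy of bounded continuous solutions\<close>

theorem theorem3p2:
  fixes M :: "'a measure" and \<alpha> \<beta> :: "'a \<Rightarrow> real"
  assumes "prob_space M"
    and "(\<lambda>\<omega>. (\<alpha> \<omega>, \<beta> \<omega>)) \<in> borel_measurable M"
    and "\<P>(\<omega> in M. \<alpha> \<omega> \<noteq> 0) = 1"
    and "\<P>(\<omega> in M. \<bar>\<alpha> \<omega>\<bar> \<noteq> 1) > 0"
    and "\<And>c::real. \<P>(\<omega> in M. \<alpha> \<omega> * (c - \<beta> \<omega>) = c) < 1"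
    and "integrable M (\<lambda>\<omega>. ln \<bar>\<alpha> \<omega>\<bar>)"
    and "(\<integral>\<omega>. ln \<bar>\<alpha> \<omega>\<bar> \<partial>M) < 0"
    and "integrable M (\<lambda>\<omega>. ln (max \<bar>\<beta> \<omega>\<bar> 1))"
  shows "\<forall>y::real \<Rightarrow> real. bounded (range y) \<longrightarrow> continuous_on UNIV y \<longrightarrow>
           (\<forall>x. y x = (\<integral>\<omega>. y (\<alpha> \<omega> * (x - \<beta> \<omega>)) \<partial>M)) \<longrightarrow>
           (\<exists>c. \<forall>x. y x = c)"
proof (intro allI impI)
  fix y :: "real \<Rightarrow> real"
  assume bounded: "bounded (range y)" and cont: "continuous_on UNIV y"
    and harmonic: "\<forall>x. y x = (\<integral>\<omega>. y (\<alpha> \<omega> * (x - \<beta> \<omega>)) \<partial>M)"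
  interpret prob_space M by fact
  let ?S = "stream_space M"
  interpret S: prob_space ?S by (rule prob_space_stream_space)
  define F where "F s x = \<alpha> s * (x - \<beta> s)" for s x
  obtain B where B: "\<And>x. \<bar>y x\<bar> \<le> B"
    using bounded by (auto simp: bounded_iff)
  have [measurable]: "y \<in> borel_measurable borel"
    using cont by (rule borel_measurable_continuous_onI)
  have [measurable]: "\<alpha> \<in> borel_measurable M"
    using measurable_compose[OF assms(2) borel_measurable_continuous_onI[OF continuous_on_fst[OF continuous_on_id]]]
    by simp
  have [measurable]: "\<beta> \<in> borel_measurable M"
    using measurable_compose[OF assms(2) borel_measurable_continuous_onI[OF continuous_on_snd[OF continuous_on_id]]]
    by simp
  have F: "case_prod F \<in> borel_measurable (M \<Otimes>\<^sub>M borel)"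
    unfolding F_def by measurable
  have meas [measurable]: "(\<lambda>\<omega>. y (backward_iterate F n \<omega> x)) \<in> borel_measurable ?S" for n x
    by (rule measurable_compose[OF measurable_backward_iterate[OF F]]) measurable
  have int: "integrable ?S (\<lambda>\<omega>. y (backward_iterate F n \<omega> x))" for n x
    using B by (intro S.integrable_const_bound[where B = B] meas) auto
  have mean: "(\<integral>\<omega>. y (backward_iterate F n \<omega> x) \<partial>?S) = y x" for n x
  proof (rule integral_backward_iterate[OF F _ B])
    show "y x = (\<integral>s. y (F s x) \<partial>M)" for x
      unfolding F_def using harmonic by (rule spec)
  qed measurable
  have "y x = y 0" for x
  proof -
    \<comment> \<open>Both iterates run along the same stream and share their limit, so by
      continuity of \<open>y\<close> the integrand tends to 0 almost surely, dominated by
      \<open>2 * B\<close>. By \<open>mean\<close>, each integral equals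
      \<open>y x - y 0\<close>.\<close>
    have "(\<lambda>n. \<integral>\<omega>. y (backward_iterate F n \<omega> x) - y (backward_iterate F n \<omega> 0) \<partial>?S)
        \<longlonglongrightarrow> (\<integral>\<omega>. 0 \<partial>?S)"
    proof (rule integral_dominated_convergence[where w = "\<lambda>_. 2 * B"])
      show "AE \<omega> in ?S. (\<lambda>n. y (backward_iterate F n \<omega> x) - y (backward_iterate F n \<omega> 0)) \<longlonglongrightarrow> 0"
        using AE_backward_iterate_affine_tendsto[OF assms(6-8)]
      proof eventually_elim
        case (elim \<omega>)
        then obtain z where z: "\<And>x. (\<lambda>n. backward_iterate F n \<omega> x) \<longlonglongrightarrow> z"
          unfolding F_def by blast
        have "(\<lambda>n. y (backward_iterate F n \<omega> x)) \<longlonglongrightarrow> y z" for x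
          using cont z by (rule continuous_on_tendsto_compose) auto
        from tendsto_diff[OF this this] show ?case by simp
      qed
      show "AE \<omega> in ?S. norm (y (backward_iterate F n \<omega> x) - y (backward_iterate F n \<omega> 0)) \<le> 2 * B" for n
      proof (rule AE_I2)
        fix \<omega>
        show "norm (y (backward_iterate F n \<omega> x) - y (backward_iterate F n \<omega> 0)) \<le> 2 * B"
          using B[of "backward_iterate F n \<omega> x"] B[of "backward_iterate F n \<omega> 0"]
          unfolding real_norm_def by linarith
      qed
    qed auto
    then have "(\<lambda>n::nat. y x - y 0) \<longlonglongrightarrow> 0"
      by (simp add: int mean)
    then show ?thesis
      by (simp add: LIMSEQ_const_iff)
  qed
  then show "\<exists>c. \<forall>x. y x = c" by (intro exI allI)
qed

end
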